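(* Consider the generalized semi-infinite program (GSIP) of minimizing $f(x)$ over $\mathcal{F}=\{x\in X:\ g(x,u)\ge 0\ \ \forall u\in U(x)\}$, and suppose the exchange algorithm with polynomial extensions described in the context is run on it. If $\hat g_k\ge 0$ at the $k$th loop, then the minimizer $\hat x_k$ of $(P_k)$ is also a minimizer of the GSIP.
   Context: **Problem.** $f$ is a real polynomial in $x\in\mathbb{R}^n$, and $g(x,u)=(g_1(x,u),\dots,g_s(x,u))$ is a vector of real polynomials in $(x,u)\in\mathbb{R}^n\times\mathbb{R}^p$. The sets are $$X=\{x\in\mathbb{R}^n:\ c_i(x)=0\ (i\in\mathcal{I}_1),\ c_j(x)\ge 0\ (j\in\mathcal{J}_1)\},$$ $$U(x)=\{u\in\mathbb{R}^p:\ h_i(x,u)=0\ (i\in\mathcal{I}_2),\ h_j(x,u)\ge 0\ (j\in\mathcal{J}_2)\},$$ with all $c_i,c_j,h_i,h_j$ polynomials and $\mathcal{I}_1,\mathcal{J}_1,\mathcal{I}_2,\mathcal{J}_2$ finite label sets. Vector inequalities are entrywise. If $U(x)=\emptyset$, the constraint "$g(x,u)\ge 0\ \forall u\in U(x)$" holds automatically. Write $[s]=\{1,\dots,s\}$. **Algorithm.** Start with $k=0$ and $\mathcal{F}_0=X$ (or any set $\mathcal{F}_0\supseteq\mathcal{F}$). In loop $k$: 1. Solve the problem $(P_k)$: $\min f(x)$ subject to $x\in\mathcal{F}_k$. If it is infeasible, output that the GSIP is infeasible and has no minimizers. If it is feasible and has minimizers, compute a minimizer $\hat x_k$. 2. For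 each $j\in[s]$, solve $(Q_{k,j})$: $\min g_j(\hat x_k,u)$ subject to $u\in U(\hat x_k)$. If $U(\hat x_k)=\emptyset$, set $\hat g_k=+\infty$. If $U(\hat x_k)\ne\emptyset$, compute the optimal value $\hat g_{k,j}$ and a minimizer $\hat u_{k,j}$ (if any) of $(Q_{k,j})$, and set $\hat g_k=\min_{j\in[s]}\hat g_{k,j}$. (If $(Q_{k,j})$ is unbounded below, i.e. $\hat g_{k,j}=-\infty$, one can choose $\hat u_{k,j}$ to be any point of $U(\hat x_k)$ with $g_j(\hat x_k,\hat u_{k,j})<0$.) 3. If $\hat g_k\ge 0$, output that $\hat x_k$ is a minimizer of the GSIP and stop. If $\hat g_k<0$, let $\mathcal{N}_k=\{j\in[s]:\hat g_{k,j}<0\}$ and, for each $j\in\mathcal{N}_k$, construct a polynomial extension $q_{k,j}$ of $\hat u_{k,j}$ for $U(x)$, i.e. a polynomial vector function $q_{k,j}:\mathbb{R}^n\to\mathbb{R}^p$ with $q_{k,j}(\hat x_k)=\hat u_{k,j}$ and $q_{k,j}(x)\in U(x)$ for all $x\in X$. 4. Set $\mathcal{F}_{k+1}=\{x\in\mathcal{F}_k:\ g(x,q_{k,j}(x))\ge 0,\ j\in\mathcal{N}_k\}$, replace $k$ by $k+1$ and return to step 1.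
   Formalization: The initial set F_0 is required to satisfy F ⊆ F_0 ⊆ X rather than only F_0 ⊇ F; without F_0 ⊆ X the claim fails, e.g. f(x)=x, X={x≥0}, U(x)={0}, g=1, F_0=[-1,∞), where the minimizer -1 of (P_0) is not in X. *)

theory Defs
  imports "HOL-Analysis.Analysis"
begin

text \<open>
  Polynomials in \<open>x\<close> and in \<open>(x, u)\<close> are rendered as the polynomial functions of
  \<open>HOL-Analysis\<close> on \<open>real ^ 'n\<close> and \<open>(real ^ 'n) \<times> (real ^ 'p)\<close>. The inequality \<open>0 \<le> v\<close> for
  \<open>v :: real ^ 's\<close> is the entrywise one, and the index set \<open>[s]\<close> is the type \<open>'s\<close>.
\<close>

definition constraint_set :: "'i set \<Rightarrow> 'i set \<Rightarrow> ('i \<Rightarrow> 'a \<Rightarrow> real) \<Rightarrow> 'a set" where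
  "constraint_set I J c = {x. (\<forall>i\<in>I. c i x = 0) \<and> (\<forall>j\<in>J. c j x \<ge> 0)}"

definition gsip_feasible ::
  "(real ^ 'n) set \<Rightarrow> (real ^ 'n \<Rightarrow> (real ^ 'p) set) \<Rightarrow> ((real ^ 'n) \<times> (real ^ 'p) \<Rightarrow> real ^ 's)
    \<Rightarrow> (real ^ 'n) set" where
  "gsip_feasible X U g = {x \<in> X. \<forall>u \<in> U x. 0 \<le> g (x, u)}"

text \<open>
  The optimal value of the lower level problem \<open>min g\<^sub>j(x, u)\<close> over \<open>u \<in> U x\<close>, as an extended
  real; it is \<open>-\<infinity>\<close> if the problem is unbounded below.
\<close>

definition lower_value ::
  "(real ^ 'n \<Rightarrow> (real ^ 'p) set) \<Rightarrow> ((real ^ 'n) \<times> (real ^ 'p) \<Rightarrow> real ^ 's)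
    \<Rightarrow> real ^ 'n \<Rightarrow> 's \<Rightarrow> ereal" where
  "lower_value U g x j = (INF u \<in> U x. ereal (g (x, u) $ j))"

definition min_lower_value ::
  "(real ^ 'n \<Rightarrow> (real ^ 'p) set) \<Rightarrow> ((real ^ 'n) \<times> (real ^ 'p) \<Rightarrow> real ^ 's::finite)
    \<Rightarrow> real ^ 'n \<Rightarrow> ereal" where
  "min_lower_value U g x = (if U x = {} then \<infinity> else (MIN j. lower_value U g x j))"

definition violated ::
  "(real ^ 'n \<Rightarrow> (real ^ 'p) set) \<Rightarrow> ((real ^ 'n) \<times> (real ^ 'p) \<Rightarrow> real ^ 's)
    \<Rightarrow> real ^ 'n \<Rightarrow> 's set" where
  "violated U g x = {j. lower_value U g x j < 0}"

text \<open>
  The admissible choices of the point \<open>u\<close> computed from the \<open>j\<close>-th lower level problem at \<open>x\<close>.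
  There is none if the optimal value is finite but not attained.
\<close>

definition lower_choice ::
  "(real ^ 'n \<Rightarrow> (real ^ 'p) set) \<Rightarrow> ((real ^ 'n) \<times> (real ^ 'p) \<Rightarrow> real ^ 's)
    \<Rightarrow> real ^ 'n \<Rightarrow> 's \<Rightarrow> real ^ 'p \<Rightarrow> bool" where
  "lower_choice U g x j u \<longleftrightarrow>
     (if lower_value U g x j = -\<infinity> then u \<in> U x \<and> g (x, u) $ j < 0
      else is_arg_min (\<lambda>u. g (x, u) $ j) (\<lambda>u. u \<in> U x) u)"

definition polynomial_extension ::
  "(real ^ 'n) set \<Rightarrow> (real ^ 'n \<Rightarrow> (real ^ 'p) set) \<Rightarrow> real ^ 'n \<Rightarrow> real ^ 'p
    \<Rightarrow> (real ^ 'n \<Rightarrow> real ^ 'p) \<Rightarrow> bool" where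
  "polynomial_extension X U xh uh q \<longleftrightarrow>
     polynomial_function q \<and> q xh = uh \<and> (\<forall>x\<in>X. q x \<in> U x)"

text \<open>
  The algorithm has reached loop \<open>k\<close> and found a minimizer \<open>xh k\<close> of the problem of minimizing
  \<open>f\<close> over \<open>F k\<close>; all loops before \<open>k\<close> were completed without stopping. Only the values
  \<open>F i\<close>, \<open>xh i\<close> with \<open>i \<le> k\<close> and \<open>uh i j\<close>, \<open>q i j\<close> with \<open>i < k\<close> and \<open>j\<close> violated at \<open>xh i\<close> matter.
  The initial set \<open>F 0\<close> may be any set between the feasible set of the GSIP and \<open>X\<close>.
\<close>

definition exchange_run ::
  "(real ^ 'n \<Rightarrow> real) \<Rightarrow> (real ^ 'n) set \<Rightarrow> (real ^ 'n \<Rightarrow> (real ^ 'p) set)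
    \<Rightarrow> ((real ^ 'n) \<times> (real ^ 'p) \<Rightarrow> real ^ 's::finite) \<Rightarrow> nat
    \<Rightarrow> (nat \<Rightarrow> (real ^ 'n) set) \<Rightarrow> (nat \<Rightarrow> real ^ 'n) \<Rightarrow> (nat \<Rightarrow> 's \<Rightarrow> real ^ 'p)
    \<Rightarrow> (nat \<Rightarrow> 's \<Rightarrow> real ^ 'n \<Rightarrow> real ^ 'p) \<Rightarrow> bool" where
  "exchange_run f X U g k F xh uh q \<longleftrightarrow>
     gsip_feasible X U g \<subseteq> F 0 \<and> F 0 \<subseteq> X \<and>
     (\<forall>i\<le>k. is_arg_min f (\<lambda>x. x \<in> F i) (xh i)) \<and>
     (\<forall>i<k. min_lower_value U g (xh i) < 0 \<and>
        (\<forall>j\<in>violated U g (xh i).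
           lower_choice U g (xh i) j (uh i j) \<and>
           polynomial_extension X U (xh i) (uh i j) (q i j)) \<and>
        F (Suc i) = {x \<in> F i. \<forall>j\<in>violated U g (xh i). 0 \<le> g (x, q i j x)})"

end

theory Submission
  imports Defs
begin

text \<open>
  A point of the feasible set survives every cut: the extension maps it into \<open>U x\<close>, where
  \<open>g\<close> is nonnegative. So each \<open>F k\<close> is a relaxation of the feasible set, and a minimizer of the
  relaxed problem that is itself feasible is optimal.
\<close>

lemma gsip_feasible_subset_cut:
  assumes "gsip_feasible X U g \<subseteq> S"
    and "\<And>j. j \<in> N \<Longrightarrow> polynomial_extension X U xh (uh j) (q j)"
  shows "gsip_feasible X U g \<subseteq> {x \<in> S. \<forall>j\<in>N. 0 \<le> g (x, q j x)}"
  using assms by (auto simp: gsip_feasible_def polynomial_extension_def)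

text \<open>Both inclusions are needed at the end: the first makes the problem over
  \<open>F k\<close> a relaxation, the second puts its minimizer in \<open>X\<close>. Cutting only
  shrinks the sets, so the second is inherited.\<close>

lemma exchange_run_relaxation:
  assumes "exchange_run f X U g k F xh uh q" and "i \<le> k"
  shows "gsip_feasible X U g \<subseteq> F i \<and> F i \<subseteq> X"
  using \<open>i \<le> k\<close>
proof (induction i)
  case 0
  then show ?case using assms(1) by (simp add: exchange_run_def)
next
  case (Suc i)
  let ?N = "violated U g (xh i)"
  \<comment> \<open>The run prescribes \<open>F (Suc i)\<close> only for completed loops
    \<open>i < k\<close>; \<open>Suc i \<le> k\<close> gives just this, so the induction reaches
    \<open>F k\<close>.\<close>
  have "i < k" using Suc.prems by simp
  then have F_Suc: "F (Suc i) = {x \<in> F i. \<forall>j\<in>?N. 0 \<le> g (x, q i j x)}"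
    and ext: "\<And>j. j \<in> ?N \<Longrightarrow> polynomial_extension X U (xh i) (uh i j) (q i j)"
    using assms(1) by (auto simp: exchange_run_def)
  have "gsip_feasible X U g \<subseteq> F i" and "F i \<subseteq> X"
    using Suc by simp_all
  then show ?case
    using gsip_feasible_subset_cut[of X U g "F i" ?N "xh i" "uh i" "q i", OF _ ext]
    unfolding F_Suc by blast
qed

text \<open>Links the stopping test to the semi-infinite constraint. For empty \<open>U x\<close>
  the value is infinite and the constraint vacuous, so both sides hold.\<close>

lemma min_lower_value_nonneg_iff:
  "min_lower_value U g x \<ge> 0 \<longleftrightarrow> (\<forall>u\<in>U x. 0 \<le> g (x, u))"
proof (cases "U x = {}")
  case False
  \<comment> \<open>An extended real infimum is at least 0 exactly when 0 is a lower bound, whether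
    or not it is attained or finite.\<close>
  have "lower_value U g x j \<ge> 0 \<longleftrightarrow> (\<forall>u\<in>U x. 0 \<le> g (x, u) $ j)" for j
    by (simp add: lower_value_def le_INF_iff)
  with False show ?thesis
    by (auto simp: min_lower_value_def less_eq_vec_def)
qed (simp add: min_lower_value_def)

lemma is_arg_min_subset:
  assumes "is_arg_min f (\<lambda>x. x \<in> S) a" and "T \<subseteq> S" and "a \<in> T"
  shows "is_arg_min f (\<lambda>x. x \<in> T) a"
  using assms by (auto simp: is_arg_min_def)

theorem theorem3p4:
  fixes f :: "real ^ 'n \<Rightarrow> real"
    and g :: "(real ^ 'n) \<times> (real ^ 'p) \<Rightarrow> real ^ 's"
    and c :: "'a \<Rightarrow> real ^ 'n \<Rightarrow> real" and I1 J1 :: "'a set"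
    and h :: "'b \<Rightarrow> (real ^ 'n) \<times> (real ^ 'p) \<Rightarrow> real" and I2 J2 :: "'b set"
    and X :: "(real ^ 'n) set" and U :: "real ^ 'n \<Rightarrow> (real ^ 'p) set"
    and F :: "nat \<Rightarrow> (real ^ 'n) set" and xh :: "nat \<Rightarrow> real ^ 'n"
    and uh :: "nat \<Rightarrow> 's \<Rightarrow> real ^ 'p" and q :: "nat \<Rightarrow> 's \<Rightarrow> real ^ 'n \<Rightarrow> real ^ 'p"
    and k :: nat
  assumes "real_polynomial_function f" and "polynomial_function g"
    and "finite I1" and "finite J1" and "finite I2" and "finite J2"
    and "\<And>i. i \<in> I1 \<union> J1 \<Longrightarrow> real_polynomial_function (c i)"
    and "\<And>i. i \<in> I2 \<union> J2 \<Longrightarrow> real_polynomial_function (h i)"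
    and "X = constraint_set I1 J1 c"
    and "\<And>x. U x = constraint_set I2 J2 (\<lambda>i u. h i (x, u))"
    and "exchange_run f X U g k F xh uh q"
    and "min_lower_value U g (xh k) \<ge> 0"
  shows "is_arg_min f (\<lambda>x. x \<in> gsip_feasible X U g) (xh k)"
proof (rule is_arg_min_subset)
  show min: "is_arg_min f (\<lambda>x. x \<in> F k) (xh k)"
    using assms(11) by (simp add: exchange_run_def)
  show "gsip_feasible X U g \<subseteq> F k"
    using exchange_run_relaxation[OF assms(11)] by blast
  \<comment> \<open>The stopping test only controls \<open>g\<close> on \<open>U (xh k)\<close>;
    membership in \<open>X\<close> comes from \<open>F k \<subseteq> X\<close>.\<close>
  have "xh k \<in> X"
    using exchange_run_relaxation[OF assms(11)] min by (auto simp: is_arg_min_def)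
  then show "xh k \<in> gsip_feasible X U g"
    using assms(12) by (simp add: gsip_feasible_def min_lower_value_nonneg_iff)
qed

end
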